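(* Let $\Theta=(\theta_1,\dots,\theta_m)\in\mathbb{R}^m$. The core map $\mathcal{C}_\Theta$ acts blockwise: there are linear maps $\mathcal{C}_{[i,j]}$, $i,j\le k$, such that for all $M\in\mathbf{Skew}_n$, the matrix $N=\mathcal{C}_\Theta(M)$ has blocks $N_{[i,j]}=\mathcal{C}_{[i,j]}(M_{[i,j]})$ for all $i,j\le k$, and these linear maps are given by $$\begin{cases}\mathrm{vec}(\mathcal{C}_{[i,j]}(M_{[i,j]}))=\mathfrak{X}(a_{i,j},b_{i,j},c_{i,j},d_{i,j})\,\mathrm{vec}(M_{[i,j]}), & i,j\le m,\\ \mathrm{vec}(\mathcal{C}_{[m+1,j]}(M_{[m+1,j]}))=\mathfrak{Y}(r_j,s_j)\,\mathrm{vec}(M_{[m+1,j]}), & j\le m\ (\text{when } n=2m+1),\\ \mathcal{C}_{[m+1,m+1]}(M_{[m+1,m+1]})=0 & (\text{when } n=2m+1),\end{cases}$$ where $a_{i,j}=\mathrm{sinc}(\theta_i-\theta_j)$, $b_{i,j}=\mathrm{cosc}(\theta_i-\theta_j)$, $c_{i,j}=\mathrm{sinc}(\theta_i+\theta_j)$, $d_{i,j}=\mathrm{cosc}(\theta_i+\theta_j)$, $r_j=\mathrm{sinc}(\theta_j)$, $s_j=\mathrm{cosc}(\theta_j)$.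
   Context: Let $n\ge2$, $m=\lfloor n/2\rfloor$, $k=\lceil n/2\rceil$, and $\mathbf{Skew}_n=\{A\in\mathbb{R}^{n\times n}:A+A^{T}=0\}$. Block notation: the indices $1,\dots,n$ are grouped as $\{1,2\},\{3,4\},\dots,\{2m-1,2m\}$ and, if $n=2m+1$, a last group $\{n\}$. For an $n\times n$ matrix $X$, $X_{[i,j]}$ ($i,j\le k$) is the block with rows in the $i$-th group and columns in the $j$-th group; so it is $2\times2$ for $i,j\le m$, and for $n=2m+1$ (where $k=m+1$) $X_{[m+1,j]}$ is $1\times2$ and $X_{[m+1,m+1]}$ is $1\times1$. For skew-symmetric $X$, $X_{[j,i]}=-X_{[i,j]}^{T}$. $\mathrm{vec}$ stacks the columns of a matrix into a column vector (so the vec of a $1\times 2$ block is its transpose). $\mathrm{sinc}(0)=1$, $\mathrm{sinc}(x)=\sin(x)/x$ for $x\ne0$; $\mathrm{cosc}(0)=0$, $\mathrm{cosc}(x)=(\cos(x)-1)/x$ for $x\neq0$. For real numbers $a,b,c,d,r,s$: $$\mathfrak{X}(a,b,c,d)=\frac12\begin{bmatrix}a+c&-b-d&b-d&a-c\\ b+d&a+c&-a+c&b-d\\ -b+d&-a+c&a+c&-b-d\\ a-c&-b+d&b+d&a+c\end{bmatrix},\qquad \mathfrak{Y}(r,s)=\begin{bmatrix}r&-s\\ s&r\end{bmatrix}.$$ Core map: for $\Theta\in\mathbb{R}^m$ put $\lambda_{2i-1}=-\theta_i\imath$, $\lambda_{2i}=\theta_i\imath$ for $i\le m$, and $\lambda_n=0$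 if $n=2m+1$ ($\imath$ is the imaginary unit). Let $\Phi\in\mathbb{C}^{n\times n}$ have entries $\phi_{pq}=(e^{\lambda_q-\lambda_p}-1)/(\lambda_q-\lambda_p)$ if $\lambda_p\ne\lambda_q$ and $\phi_{pq}=1$ if $\lambda_p=\lambda_q$. Let $U=\frac{\sqrt2}{2}\begin{bmatrix}1&1\\ \imath&-\imath\end{bmatrix}$ and let $U_n=\mathrm{diag}(U,\dots,U)$ ($m$ copies) if $n=2m$, $U_n=\mathrm{diag}(U,\dots,U,1)$ if $n=2m+1$. The core map is $\mathcal{C}_\Theta:\mathbf{Skew}_n\to\mathbf{Skew}_n$, $\mathcal{C}_\Theta(M)=U_n\big((U_n^{H}MU_n)\odot\Phi\big)U_n^{H}$, where $\odot$ is the entrywise (Hadamard) product and $^{H}$ the conjugate transpose. *)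

theory Defs
  imports
    "HOL-Probability.Sinc_Integral"
    "Jordan_Normal_Form.Schur_Decomposition"
    "Jordan_Normal_Form.VS_Connect"
    "Jordan_Normal_Form.DL_Submatrix"
begin

(* All indices start at 0: the entries of an n x n matrix are indexed by 0..n-1, the components
   of Theta by 0..m-1 and the groups by 0..k-1, where m = n div 2 and k = (n + 1) div 2.
   The function sinc is the one of HOL-Probability.Sinc_Integral, with sinc 0 = 1. *)

no_notation Finite_Cartesian_Product.vec_nth (infixl "$" 90)

definition skew_mats :: "nat \<Rightarrow> real mat set" where
  "skew_mats n = {A \<in> carrier_mat n n. A + transpose_mat A = 0\<^sub>m n n}"

(* For odd n the intersection turns the last group into the singleton {n - 1}. *)
definition index_group :: "nat \<Rightarrow> nat \<Rightarrow> nat set" where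
  "index_group n i = {2 * i, 2 * i + 1} \<inter> {..<n}"

definition block :: "'a mat \<Rightarrow> nat \<Rightarrow> nat \<Rightarrow> 'a mat" where
  "block X i j = submatrix X (index_group (dim_row X) i) (index_group (dim_col X) j)"

(* Linear maps from the space of [i,j]-blocks of n x n real matrices to itself. *)
definition block_linear :: "nat \<Rightarrow> nat \<Rightarrow> nat \<Rightarrow> (real mat \<Rightarrow> real mat) \<Rightarrow> bool" where
  "block_linear n i j f \<longleftrightarrow>
     (let V = module_mat TYPE(real) (card (index_group n i)) (card (index_group n j))
      in linear_map class_ring V V f)"

(* vec: the columns of A stacked on top of each other. *)
definition stack_cols :: "'a mat \<Rightarrow> 'a vec" where
  "stack_cols A =
     Matrix.vec (dim_row A * dim_col A) (\<lambda>l. A $$ (l mod dim_row A, l div dim_row A))"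

definition hadamard :: "'a :: times mat \<Rightarrow> 'a mat \<Rightarrow> 'a mat" where
  "hadamard A B = Matrix.mat (dim_row A) (dim_col A) (\<lambda>pq. A $$ pq * B $$ pq)"

definition cosc :: "real \<Rightarrow> real" where
  "cosc x = (if x = 0 then 0 else (cos x - 1) / x)"

definition frakX :: "real \<Rightarrow> real \<Rightarrow> real \<Rightarrow> real \<Rightarrow> real mat" where
  "frakX a b c d = (1 / 2) \<cdot>\<^sub>m mat_of_rows_list 4
     [[ a + c, - b - d,   b - d,   a - c],
      [ b + d,   a + c, - a + c,   b - d],
      [- b + d, - a + c,  a + c, - b - d],
      [ a - c, - b + d,   b + d,   a + c]]"

definition frakY :: "real \<Rightarrow> real \<Rightarrow> real mat" where
  "frakY r s = mat_of_rows_list 2 [[r, - s], [s, r]]"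

(* Since p counts from 0, even p < 2m carries - theta i and odd p carries + theta i;
   p = 2m occurs as an index only for odd n. *)
definition core_lambda :: "nat \<Rightarrow> real vec \<Rightarrow> nat \<Rightarrow> complex" where
  "core_lambda n \<Theta> p =
     (if p = 2 * (n div 2) then 0
      else if even p then - (complex_of_real (\<Theta> $ (p div 2)) * \<i>)
      else complex_of_real (\<Theta> $ (p div 2)) * \<i>)"

definition core_Phi :: "nat \<Rightarrow> real vec \<Rightarrow> complex mat" where
  "core_Phi n \<Theta> = Matrix.mat n n (\<lambda>(p, q).
     let x = core_lambda n \<Theta> p; y = core_lambda n \<Theta> q
     in if x = y then 1 else (exp (y - x) - 1) / (y - x))"

definition core_U2 :: "complex mat" where
  "core_U2 = complex_of_real (sqrt 2 / 2) \<cdot>\<^sub>m mat_of_rows_list 2 [[1, 1], [\<i>, - \<i>]]"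

definition core_U :: "nat \<Rightarrow> complex mat" where
  "core_U n = diag_block_mat (replicate (n div 2) core_U2 @ (if odd n then [1\<^sub>m 1] else []))"

(* The value is kept as a complex matrix; that it is real and skew-symmetric for real
   skew-symmetric M is not built into the definition. *)
definition core_map :: "nat \<Rightarrow> real vec \<Rightarrow> real mat \<Rightarrow> complex mat" where
  "core_map n \<Theta> M =
     (let U = core_U n
      in U * hadamard (mat_adjoint U * map_mat complex_of_real M * U) (core_Phi n \<Theta>)
           * mat_adjoint U)"

end

(*
  Expanding the matrix products, core_map n Theta M has the entry
  (SUM c d. K p q c d * M c d) at (p, q), where the kernel K vanishes unless p, c lie in one group
  and q, d lie in one group, because U_n is block diagonal; so the map acts blockwise.
  Exchanging the two indices of a pair conjugates the columns of U_n and negates the lambda's,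
  so it conjugates every summand of K: the kernel is real. Since Phi is Hermitian,
  K q p d c is the conjugate of K p q c d, and the real kernel preserves skew symmetry. Finally
  (e^(ix) - 1) / (ix) = sinc x - i cosc x, and summing the four terms of a block gives
  the matrices X and Y.
*)

theory Submission
  imports Defs
begin

section \<open>Index groups, blocks, and sums supported on one group\<close>

text \<open>Pairs, the last singleton of odd \<open>n\<close> and the empty sets beyond it all
  become shifted initial segments, so later arguments treat groups of size 2, 1 and 0 alike.\<close>

lemma index_group_eq:
  "index_group n i = (\<lambda>s. 2 * i + s) ` {..<card (index_group n i)}"
proof -
  consider "2 * i + 1 < n" | "n = 2 * i + 1" | "n \<le> 2 * i"
    by linarith
  then show ?thesis
  proof cases
    case 1
    then have "index_group n i = {2 * i, 2 * i + 1}"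
      by (auto simp: index_group_def)
    then show ?thesis
      by (auto simp: numeral_2_eq_2 lessThan_Suc)
  next
    case 2
    then have "index_group n i = {2 * i}"
      by (auto simp: index_group_def)
    then show ?thesis
      by (auto simp: lessThan_Suc)
  next
    case 3
    then have "index_group n i = {}"
      by (auto simp: index_group_def)
    then show ?thesis
      by auto
  qed
qed

lemma card_index_group_pair: "i < n div 2 \<Longrightarrow> card (index_group n i) = 2"
proof -
  assume "i < n div 2"
  then have "index_group n i = {2 * i, 2 * i + 1}"
    by (auto simp: index_group_def)
  then show ?thesis
    by simp
qed

lemma card_index_group_last: "odd n \<Longrightarrow> card (index_group n (n div 2)) = 1"
proof -
  assume "odd n"
  then have "index_group n (n div 2) = {2 * (n div 2)}"
    by (auto simp: index_group_def elim!: oddE)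
  then show ?thesis
    by simp
qed

lemma index_group_less:
  assumes "s < card (index_group n i)"
  shows "2 * i + s < n" and "s < 2"
proof -
  have "2 * i + s \<in> index_group n i"
    by (subst index_group_eq) (use assms in auto)
  then show "2 * i + s < n" "s < 2"
    by (auto simp: index_group_def)
qed

text \<open>\<open>pick\<close> enumerates a set in increasing order, and exactly \<open>s\<close>
  members of the group precede \<open>2 * i + s\<close>.\<close>

lemma pick_index_group:
  assumes "s < card (index_group n i)"
  shows "pick (index_group n i) s = 2 * i + s"
proof -
  have *: "index_group n i = (\<lambda>s. 2 * i + s) ` {..<card (index_group n i)}"
    by (rule index_group_eq)
  have "2 * i + s \<in> index_group n i"
    by (subst *) (use assms in auto)
  moreover have "{a \<in> index_group n i. a < 2 * i + s} = (\<lambda>s. 2 * i + s) ` {..<s}"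
    by (subst *) (use assms in auto)
  then have "card {a \<in> index_group n i. a < 2 * i + s} = s"
    by (simp add: card_image inj_on_def)
  ultimately show ?thesis
    using pick_card_in_set by metis
qed

text \<open>Cuts the sums over \<open>{..<n}\<close> that come from matrix products down to one
  group, once block diagonality has killed the other terms.\<close>

lemma sum_index_group:
  fixes f :: "nat \<Rightarrow> 'a::comm_monoid_add"
  assumes "\<And>a. a < n \<Longrightarrow> a div 2 \<noteq> i \<Longrightarrow> f a = 0"
  shows "(\<Sum>a<n. f a) = (\<Sum>s<card (index_group n i). f (2 * i + s))"
proof -
  have "(\<Sum>a<n. f a) = sum f (index_group n i)"
    by (rule sum.mono_neutral_right) (auto simp: index_group_def intro!: assms)
  also have "\<dots> = sum f ((\<lambda>s. 2 * i + s) ` {..<card (index_group n i)})"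
    by (rule arg_cong[OF index_group_eq])
  also have "\<dots> = (\<Sum>s<card (index_group n i). f (2 * i + s))"
    by (subst sum.reindex) (auto simp: inj_on_def)
  finally show ?thesis .
qed

lemma block_eq:
  assumes "X \<in> carrier_mat n n"
  shows "block X i j = Matrix.mat (card (index_group n i)) (card (index_group n j))
           (\<lambda>(s, t). X $$ (2 * i + s, 2 * j + t))"
proof -
  \<comment> \<open>The dimensions of a \<open>submatrix\<close> are the cardinalities of sets
    filtered in this way.\<close>
  have "{a. a < n \<and> a \<in> index_group n i} = index_group n i" for i
    by (auto simp: index_group_def)
  then show ?thesis
    using assms by (auto simp: block_def submatrix_def pick_index_group intro!: eq_matI)
qed

section \<open>Entries of the unitary matrix \<open>core_U\<close>\<close>

lemma core_U2_carrier: "core_U2 \<in> carrier_mat 2 2"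
  by (rule carrier_matI) (simp_all add: core_U2_def mat_of_rows_list_def)

lemma core_U2_index:
  assumes "p < 2" "a < 2"
  shows "core_U2 $$ (p, a) =
    complex_of_real (sqrt 2 / 2) * (if p = 0 then 1 else if a = 0 then \<i> else - \<i>)"
  using assms by (auto simp: core_U2_def mat_of_rows_list_def less_2_cases_iff)

text \<open>Induction on the number of copies of \<open>A\<close>: peeling off the first one shifts
  both indices by 2. The carrier is part of the claim because the entries of a block diagonal matrix
  depend on the dimensions of its blocks. The size \<open>l\<close> of the last block is free so
  that both parities of \<open>n\<close> are covered.\<close>

lemma diag_block_replicate:
  assumes "A \<in> carrier_mat 2 2" "L \<in> carrier_mat l l"
  shows "diag_block_mat (replicate m A @ [L]) \<in> carrier_mat (2 * m + l) (2 * m + l) \<and>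
    (\<forall>p<2 * m + l. \<forall>q<2 * m + l. diag_block_mat (replicate m A @ [L]) $$ (p, q) =
       (if p < 2 * m \<and> q < 2 * m
        then if p div 2 = q div 2 then A $$ (p mod 2, q mod 2) else 0
        else if 2 * m \<le> p \<and> 2 * m \<le> q then L $$ (p - 2 * m, q - 2 * m) else 0))"
proof (induction m)
  case 0
  then show ?case
    using assms by auto
next
  case (Suc m)
  let ?D = "diag_block_mat (replicate m A @ [L])"
  have D: "dim_row ?D = 2 * m + l" "dim_col ?D = 2 * m + l"
    using Suc.IH by auto
  have A: "dim_row A = 2" "dim_col A = 2"
    using assms by auto
  have IH: "?D $$ (p, q) = (if p < 2 * m \<and> q < 2 * m
        then if p div 2 = q div 2 then A $$ (p mod 2, q mod 2) else 0
        else if 2 * m \<le> p \<and> 2 * m \<le> q then L $$ (p - 2 * m, q - 2 * m) else 0)"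
    if "p < 2 * m + l" "q < 2 * m + l" for p q
    using Suc.IH that by blast
  have "diag_block_mat (replicate (Suc m) A @ [L]) $$ (p, q) =
       (if p < 2 * Suc m \<and> q < 2 * Suc m
        then if p div 2 = q div 2 then A $$ (p mod 2, q mod 2) else 0
        else if 2 * Suc m \<le> p \<and> 2 * Suc m \<le> q
          then L $$ (p - 2 * Suc m, q - 2 * Suc m) else 0)"
    if pq: "p < 2 * Suc m + l" "q < 2 * Suc m + l" for p q
  proof -
    have step: "diag_block_mat (replicate (Suc m) A @ [L]) $$ (p, q) =
       (if p < 2 then if q < 2 then A $$ (p, q) else 0
        else if q < 2 then 0 else ?D $$ (p - 2, q - 2))"
      using pq by (auto simp: Let_def A D)
    consider (corner) "p < 2" "q < 2" | (row) "p < 2" "2 \<le> q" | (col) "2 \<le> p" "q < 2"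
      | (rest) "2 \<le> p" "2 \<le> q"
      by linarith
    then show ?thesis
    proof cases
      case corner
      then show ?thesis
        unfolding step by simp
    next
      case row
      then have "0 < q div 2"
        by (simp add: div_greater_zero_iff)
      with row show ?thesis
        unfolding step by (simp add: div_eq_0_iff)
    next
      case col
      then have "0 < p div 2"
        by (simp add: div_greater_zero_iff)
      with col show ?thesis
        unfolding step by (simp add: div_eq_0_iff)
    next
      case rest
      \<comment> \<open>Removing two successors lowers the quotient by 2 by one and keeps the
        remainder, which matches the entries of the smaller matrix.\<close>
      then obtain p' q' where *: "p = Suc (Suc p')" "q = Suc (Suc q')"
        by (metis add_2_eq_Suc le_Suc_ex)
      then have "p' < 2 * m + l" "q' < 2 * m + l"
        using pq by auto
      from IH[OF this] show ?thesis
        unfolding step unfolding * by simp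
    qed
  qed
  moreover have "diag_block_mat (replicate (Suc m) A @ [L]) \<in>
      carrier_mat (2 * Suc m + l) (2 * Suc m + l)"
    using D A by (auto simp: Let_def)
  ultimately show ?case
    by blast
qed

text \<open>For even \<open>n\<close> the appended block is 0 x 0 and contributes nothing; this
  gives one formula for both parities.\<close>

lemma core_U_as_diag:
  "core_U n = diag_block_mat (replicate (n div 2) core_U2 @ [1\<^sub>m (n mod 2)])"
proof (cases "odd n")
  case True
  then show ?thesis
    by (simp add: core_U_def odd_iff_mod_2_eq_one)
next
  case False
  have "diag_block_mat (As @ [1\<^sub>m 0]) = diag_block_mat As" for As :: "complex mat list"
    by (simp only: diag_block_mat_append diag_block_mat_singleton Let_def)
       (auto intro!: eq_matI)
  with False show ?thesis
    by (simp add: core_U_def even_iff_mod_2_eq_zero)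
qed

lemma core_U_carrier [simp]: "core_U n \<in> carrier_mat n n"
  using diag_block_replicate[OF core_U2_carrier one_carrier_mat[of "n mod 2"], of "n div 2",
      THEN conjunct1]
  unfolding core_U_as_diag by simp

lemma core_U_index:
  assumes "p < n" "a < n"
  shows "core_U n $$ (p, a) =
    (if p div 2 \<noteq> a div 2 then 0
     else if p = 2 * (n div 2) then 1
     else complex_of_real (sqrt 2 / 2) * (if even p then 1 else if even a then \<i> else - \<i>))"
proof -
  define m r where "m = n div 2" and "r = n mod 2"
  have n: "2 * m + r = n" and r: "r < 2"
    by (simp_all add: m_def r_def)
  have entry: "core_U n $$ (p, a) = (if p < 2 * m \<and> a < 2 * m
        then if p div 2 = a div 2 then core_U2 $$ (p mod 2, a mod 2) else 0
        else if 2 * m \<le> p \<and> 2 * m \<le> a then 1\<^sub>m r $$ (p - 2 * m, a - 2 * m) else 0)"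
    unfolding core_U_as_diag m_def[symmetric] r_def[symmetric]
    by (rule diag_block_replicate[OF core_U2_carrier one_carrier_mat[of r], of m,
          THEN conjunct2, rule_format])
       (use assms in \<open>simp_all only: n\<close>)
  have U2: "core_U2 $$ (p mod 2, a mod 2) =
      complex_of_real (sqrt 2 / 2) * (if even p then 1 else if even a then \<i> else - \<i>)"
    by (simp add: core_U2_index even_iff_mod_2_eq_zero)
  \<comment> \<open>An index outside the pairs exists only for odd \<open>n\<close>, and then it is
    \<open>2 * m\<close>.\<close>
  have last: "p < 2 * m \<or> p = 2 * m \<and> r = 1" "a < 2 * m \<or> a = 2 * m \<and> r = 1"
    using assms n r by linarith+
  have div: "p div 2 < m \<longleftrightarrow> p < 2 * m" "a div 2 < m \<longleftrightarrow> a < 2 * m"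
    by (simp_all add: div_less_iff_less_mult mult.commute)
  have "core_U n $$ (p, a) = (if p div 2 \<noteq> a div 2 then 0 else if p = 2 * m then 1
     else complex_of_real (sqrt 2 / 2) * (if even p then 1 else if even a then \<i> else - \<i>))"
  proof (cases "p < 2 * m")
    case True
    then show ?thesis
      unfolding entry U2 using div by auto
  next
    case False
    then have p: "p = 2 * m" "r = 1" "p div 2 = m"
      using last(1) by simp_all
    show ?thesis
    proof (cases "a < 2 * m")
      case True
      then have "p div 2 \<noteq> a div 2"
        using p(3) div(2) by simp
      then show ?thesis
        unfolding entry using True p(1) by simp
    next
      case False
      then have "a = 2 * m"
        using last(2) by simp
      then show ?thesis
        unfolding entry using p(1,2) by simp
    qed
  qed
  then show ?thesis
    by (simp only: m_def)
qed

lemma core_U_index_eq_0: "p < n \<Longrightarrow> a < n \<Longrightarrow> p div 2 \<noteq> a div 2 \<Longrightarrow> core_U n $$ (p, a) = 0"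
  by (simp add: core_U_index)

section \<open>The core map as a sum against a kernel\<close>

text \<open>The coefficient of \<open>M $$ (c, d)\<close> in the entry \<open>(p, q)\<close> of
  \<open>core_map\<close>. With \<open>u_a\<close> for column \<open>a\<close> of
  \<open>core_U\<close>, the bracketed factors are the entries \<open>(p, c)\<close> of
  \<open>u_a u_a^H\<close> and \<open>(d, q)\<close> of \<open>u_b u_b^H\<close>.\<close>

definition core_kernel :: "nat \<Rightarrow> real vec \<Rightarrow> nat \<Rightarrow> nat \<Rightarrow> nat \<Rightarrow> nat \<Rightarrow> complex" where
  "core_kernel n \<Theta> p q c d = (\<Sum>a<n. \<Sum>b<n.
     (core_U n $$ (p, a) * cnj (core_U n $$ (c, a))) *
     (core_U n $$ (d, b) * cnj (core_U n $$ (q, b))) * core_Phi n \<Theta> $$ (a, b))"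

lemma mat_adjoint_index:
  fixes A :: "'a::conjugatable_field mat"
  assumes "p < dim_col A" "q < dim_row A"
  shows "mat_adjoint A $$ (p, q) = conjugate (A $$ (q, p))"
  using assms by (simp add: mat_adjoint_def mat_of_rows_def)

lemma mat_adjoint_carrier:
  fixes A :: "'a::conjugatable_field mat"
  assumes "A \<in> carrier_mat r c"
  shows "mat_adjoint A \<in> carrier_mat c r"
  using assms by (auto simp: mat_adjoint_def mat_of_rows_def)

lemma triple_product_index:
  fixes A B C :: "'a::comm_semiring_0 mat"
  assumes "A \<in> carrier_mat n n" "B \<in> carrier_mat n n" "C \<in> carrier_mat n n" "p < n" "q < n"
  shows "(A * B * C) $$ (p, q) = (\<Sum>a<n. \<Sum>b<n. A $$ (p, a) * B $$ (a, b) * C $$ (b, q))"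
  using assms by (simp add: scalar_prod_def lessThan_atLeast0 sum_distrib_left mult.assoc)

lemma hadamard_carrier:
  "A \<in> carrier_mat r c \<Longrightarrow> hadamard A B \<in> carrier_mat r c"
  by (auto simp: hadamard_def)

lemma hadamard_index:
  "A \<in> carrier_mat r c \<Longrightarrow> p < r \<Longrightarrow> q < c \<Longrightarrow>
    hadamard A B $$ (p, q) = A $$ (p, q) * B $$ (p, q)"
  by (auto simp: hadamard_def)

lemma core_map_carrier [simp]: "M \<in> carrier_mat n n \<Longrightarrow> core_map n \<Theta> M \<in> carrier_mat n n"
proof -
  have "dim_row (core_U n) = n"
    using core_U_carrier by blast
  then show ?thesis
    using mat_adjoint_carrier[OF core_U_carrier, of n]
    by (auto simp: core_map_def Let_def)
qed

lemma core_map_index: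
  assumes M: "M \<in> carrier_mat n n" and pq: "p < n" "q < n"
  shows "core_map n \<Theta> M $$ (p, q) =
    (\<Sum>c<n. \<Sum>d<n. core_kernel n \<Theta> p q c d * complex_of_real (M $$ (c, d)))"
proof -
  let ?U = "core_U n" and ?P = "core_Phi n \<Theta>"
  let ?M = "map_mat complex_of_real M"
  define H where "H = mat_adjoint ?U * ?M * ?U"
  have U: "?U \<in> carrier_mat n n" "mat_adjoint ?U \<in> carrier_mat n n"
    by (simp_all add: mat_adjoint_carrier)
  note Ud = carrier_matD[OF U(1)]
  have M': "?M \<in> carrier_mat n n"
    using M by simp
  have H: "H \<in> carrier_mat n n"
    unfolding H_def by (intro mult_carrier_mat[of _ n n] U M')
  note HP = hadamard_carrier[OF H, of ?P]
  have adj: "mat_adjoint ?U $$ (a, b) = cnj (?U $$ (b, a))" if "a < n" "b < n" for a b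
    using that by (simp add: mat_adjoint_index Ud)
  have H_index: "H $$ (a, b) = (\<Sum>c<n. \<Sum>d<n. cnj (?U $$ (c, a)) * M $$ (c, d) * ?U $$ (d, b))"
    if "a < n" "b < n" for a b
    unfolding H_def triple_product_index[OF U(2) M' U(1) that]
    by (intro sum.cong refl) (use that M in \<open>simp add: adj\<close>)
  have "core_map n \<Theta> M $$ (p, q) =
      (\<Sum>a<n. \<Sum>b<n. ?U $$ (p, a) * (H $$ (a, b) * ?P $$ (a, b)) * cnj (?U $$ (q, b)))"
    unfolding core_map_def Let_def H_def[symmetric] triple_product_index[OF U(1) HP U(2) pq]
    by (intro sum.cong refl) (use pq H in \<open>simp add: adj hadamard_index\<close>)
  also have "\<dots> = (\<Sum>a<n. \<Sum>b<n. \<Sum>c<n. \<Sum>d<n.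
      ?U $$ (p, a) * cnj (?U $$ (c, a)) * (?U $$ (d, b) * cnj (?U $$ (q, b))) * ?P $$ (a, b) *
      complex_of_real (M $$ (c, d)))"
    by (intro sum.cong refl)
       (simp add: H_index sum_distrib_left sum_distrib_right mult_ac)
  \<comment> \<open>The next exchanges move the sums over \<open>c\<close> and \<open>d\<close>
    outwards, so that the inner double sum over \<open>a\<close> and \<open>b\<close> is the
    kernel.\<close>
  also have "\<dots> = (\<Sum>a<n. \<Sum>c<n. \<Sum>b<n. \<Sum>d<n.
      ?U $$ (p, a) * cnj (?U $$ (c, a)) * (?U $$ (d, b) * cnj (?U $$ (q, b))) * ?P $$ (a, b) *
      complex_of_real (M $$ (c, d)))"
    by (rule sum.cong[OF refl], rule sum.swap)
  also have "\<dots> = (\<Sum>c<n. \<Sum>a<n. \<Sum>d<n. \<Sum>b<n.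
      ?U $$ (p, a) * cnj (?U $$ (c, a)) * (?U $$ (d, b) * cnj (?U $$ (q, b))) * ?P $$ (a, b) *
      complex_of_real (M $$ (c, d)))"
    by (rule trans[OF sum.swap], rule sum.cong[OF refl], rule sum.cong[OF refl], rule sum.swap)
  also have "\<dots> = (\<Sum>c<n. \<Sum>d<n. \<Sum>a<n. \<Sum>b<n.
      ?U $$ (p, a) * cnj (?U $$ (c, a)) * (?U $$ (d, b) * cnj (?U $$ (q, b))) * ?P $$ (a, b) *
      complex_of_real (M $$ (c, d)))"
    by (rule sum.cong[OF refl], rule sum.swap)
  finally show ?thesis
    by (simp add: core_kernel_def sum_distrib_right)
qed

text \<open>Each column of \<open>core_U\<close> is supported in a single group, so column
  \<open>a\<close> cannot meet rows \<open>p\<close> and \<open>c\<close> of different groups;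
  likewise column \<open>b\<close> with \<open>q\<close> and \<open>d\<close>.\<close>

lemma core_kernel_eq_0:
  assumes "p < n" "q < n" "c < n" "d < n" "p div 2 \<noteq> c div 2 \<or> q div 2 \<noteq> d div 2"
  shows "core_kernel n \<Theta> p q c d = 0"
proof -
  have "core_U n $$ (p, a) * cnj (core_U n $$ (c, a)) *
     (core_U n $$ (d, b) * cnj (core_U n $$ (q, b))) = 0" if "a < n" "b < n" for a b
    using assms that by (cases "p div 2 = a div 2"; cases "q div 2 = b div 2")
      (auto simp: core_U_index_eq_0)
  then show ?thesis
    unfolding core_kernel_def by (intro sum.neutral ballI) simp
qed

section \<open>The entries of \<open>core_Phi\<close> in terms of \<open>sinc\<close> and
  \<open>cosc\<close>\<close>

text \<open>The quotient \<open>(exp (\<i> * x) - 1) / (\<i> * x)\<close>, continued by 1 at 0. It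
  is given by real and imaginary part because these are the parameters of \<open>frakX\<close> and
  \<open>frakY\<close>.\<close>

definition phi :: "real \<Rightarrow> complex" where
  "phi x = Complex (sinc x) (- cosc x)"

lemma phi_eq: "phi x = (if x = 0 then 1 else (exp (\<i> * x) - 1) / (\<i> * x))"
proof (cases "x = 0")
  case True
  then show ?thesis
    by (simp add: phi_def cosc_def complex_eq_iff)
next
  case False
  then have "(exp (\<i> * x) - 1) / (\<i> * x) = Complex (sin x / x) (- ((cos x - 1) / x))"
    by (subst divide_eq_eq) (auto simp: exp_Euler complex_eq_iff sin_of_real cos_of_real)
  with False show ?thesis
    by (simp add: phi_def cosc_def)
qed

lemma cnj_phi: "cnj (phi x) = phi (- x)"
  by (simp add: phi_def complex_eq_iff cosc_def)

text \<open>The eigenvalues are purely imaginary; taking out \<open>\<i>\<close> leaves real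
  frequencies, whose differences are the arguments of \<open>phi\<close>.\<close>

definition core_freq :: "nat \<Rightarrow> real vec \<Rightarrow> nat \<Rightarrow> real" where
  "core_freq n \<Theta> p = (if p = 2 * (n div 2) then 0
     else if even p then - \<Theta> $ (p div 2) else \<Theta> $ (p div 2))"

lemma core_freq_even: "core_freq n \<Theta> (2 * i) = (if i = n div 2 then 0 else - \<Theta> $ i)"
  and core_freq_odd: "core_freq n \<Theta> (Suc (2 * i)) = \<Theta> $ i"
  by (simp_all add: core_freq_def Suc_double_not_eq_double)

lemma core_lambda_eq: "core_lambda n \<Theta> p = \<i> * complex_of_real (core_freq n \<Theta> p)"
  by (simp add: core_lambda_def core_freq_def)

lemma core_Phi_index:
  assumes "p < n" "q < n"
  shows "core_Phi n \<Theta> $$ (p, q) = phi (core_freq n \<Theta> q - core_freq n \<Theta> p)"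
proof -
  have "core_lambda n \<Theta> q - core_lambda n \<Theta> p = \<i> * complex_of_real (core_freq n \<Theta> q - core_freq n \<Theta> p)"
    by (simp add: core_lambda_eq right_diff_distrib)
  moreover have "core_lambda n \<Theta> p = core_lambda n \<Theta> q \<longleftrightarrow> core_freq n \<Theta> q - core_freq n \<Theta> p = 0"
    by (auto simp: core_lambda_eq)
  ultimately show ?thesis
    using assms unfolding phi_eq by (simp only: core_Phi_def Let_def index_mat case_prod_conv)
qed

section \<open>Symmetries of the kernel: conjugation and reality\<close>

text \<open>Conjugation turns \<open>phi x\<close> into \<open>phi (- x)\<close>, which transposes
  \<open>core_Phi\<close>, and it makes the two projection factors trade places.\<close>

lemma cnj_core_kernel:
  assumes "p < n" "q < n" "c < n" "d < n"
  shows "cnj (core_kernel n \<Theta> p q c d) = core_kernel n \<Theta> q p d c"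
proof -
  have "cnj (core_kernel n \<Theta> p q c d) = (\<Sum>a<n. \<Sum>b<n.
     core_U n $$ (q, b) * cnj (core_U n $$ (d, b)) *
     (core_U n $$ (c, a) * cnj (core_U n $$ (p, a))) * core_Phi n \<Theta> $$ (b, a))"
    by (auto simp: core_kernel_def core_Phi_index cnj_phi mult_ac intro!: sum.cong)
  also have "\<dots> = core_kernel n \<Theta> q p d c"
    unfolding core_kernel_def by (rule sum.swap)
  finally show ?thesis .
qed

text \<open>The involution that exchanges the eigenvalues \<open>\<plusminus>\<theta>\<^sub>i \<i>\<close> of a pair and fixes the last index for odd
  \<open>n\<close>.\<close>

definition partner :: "nat \<Rightarrow> nat \<Rightarrow> nat" where
  "partner n a = (if a = 2 * (n div 2) then a else if even a then a + 1 else a - 1)"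

lemma partner_even: "partner n (2 * i) = (if i = n div 2 then 2 * i else Suc (2 * i))"
  and partner_odd: "partner n (Suc (2 * i)) = 2 * i"
  by (simp_all add: partner_def Suc_double_not_eq_double)

lemma even_odd_cases [case_names even odd]:
  fixes a :: nat
  obtains i where "a = 2 * i" | i where "a = Suc (2 * i)"
  by (cases "even a") (auto elim!: evenE oddE)

lemma partner_less: "a < n \<Longrightarrow> partner n a < n"
  by (cases a rule: even_odd_cases) (auto simp: partner_even partner_odd)

lemma partner_partner: "a < n \<Longrightarrow> partner n (partner n a) = a"
  by (cases a rule: even_odd_cases) (auto simp: partner_even partner_odd)

lemma sum_partner: "(\<Sum>a<n. f (partner n a)) = (\<Sum>a<n. f a)"
  by (rule sum.reindex_bij_witness[of _ "partner n" "partner n"])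
     (auto simp: partner_less partner_partner)

lemma core_freq_partner: "a < n \<Longrightarrow> core_freq n \<Theta> (partner n a) = - core_freq n \<Theta> a"
  by (cases a rule: even_odd_cases)
     (auto simp: partner_even partner_odd core_freq_even core_freq_odd)

text \<open>The two columns of a pair are multiples of \<open>(1, \<i>)\<close> and
  \<open>(1, - \<i>)\<close> by the same real factor; the last column for odd \<open>n\<close> is
  real.\<close>

lemma core_U_partner:
  assumes "p < n" "a < n"
  shows "core_U n $$ (p, partner n a) = cnj (core_U n $$ (p, a))"
proof (cases a rule: even_odd_cases)
  case (even i)
  show ?thesis
  proof (cases "i = n div 2")
    case True
    \<comment> \<open>The last group is a singleton here, so the entry is 0 or 1 and equals its
      conjugate.\<close>
    have "p = 2 * i" if "p div 2 = i"
      using that True \<open>p < n\<close> by linarith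
    then show ?thesis
      using assms True by (simp add: even partner_even core_U_index)
  next
    case False
    then show ?thesis
      using assms partner_less[OF assms(2)] by (simp add: even partner_even core_U_index)
  qed
next
  case (odd i)
  then show ?thesis
    using assms by (simp add: partner_odd core_U_index)
qed

text \<open>Reindexing both sums along \<open>partner\<close> conjugates every summand, so the
  kernel equals its own conjugate.\<close>

lemma core_kernel_real:
  assumes "p < n" "q < n" "c < n" "d < n"
  shows "complex_of_real (Re (core_kernel n \<Theta> p q c d)) = core_kernel n \<Theta> p q c d"
proof -
  define f where "f a b = core_U n $$ (p, a) * cnj (core_U n $$ (c, a)) *
     (core_U n $$ (d, b) * cnj (core_U n $$ (q, b))) * core_Phi n \<Theta> $$ (a, b)" for a b
  have f_partner: "f (partner n a) (partner n b) = cnj (f a b)" if "a < n" "b < n" for a b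
  proof -
    have "core_Phi n \<Theta> $$ (partner n a, partner n b) = cnj (core_Phi n \<Theta> $$ (a, b))"
      using that by (simp add: core_Phi_index partner_less core_freq_partner cnj_phi)
    then show ?thesis
      using assms that by (simp only: f_def core_U_partner complex_cnj_mult complex_cnj_cnj)
  qed
  have "core_kernel n \<Theta> p q c d = (\<Sum>a<n. \<Sum>b<n. f a b)"
    by (simp only: core_kernel_def f_def)
  also have "\<dots> = (\<Sum>a<n. \<Sum>b<n. f (partner n a) b)"
    by (rule sum_partner[of "\<lambda>a. \<Sum>b<n. f a b", symmetric])
  also have "\<dots> = (\<Sum>a<n. \<Sum>b<n. f (partner n a) (partner n b))"
    by (rule sum.cong[OF refl], rule sum_partner[symmetric])
  also have "\<dots> = cnj (\<Sum>a<n. \<Sum>b<n. f a b)"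
    unfolding cnj_sum by (intro sum.cong refl) (simp add: f_partner)
  also have "\<dots> = cnj (core_kernel n \<Theta> p q c d)"
    by (simp only: core_kernel_def f_def)
  finally have "Im (core_kernel n \<Theta> p q c d) = Im (cnj (core_kernel n \<Theta> p q c d))"
    by (rule arg_cong[of _ _ Im])
  then show ?thesis
    by (simp add: complex_eq_iff)
qed

text \<open>The two kernel values are conjugate to each other. This is what lets the map preserve
  skew symmetry.\<close>

lemma core_kernel_swap:
  assumes "p < n" "q < n" "c < n" "d < n"
  shows "Re (core_kernel n \<Theta> q p d c) = Re (core_kernel n \<Theta> p q c d)"
  unfolding cnj_core_kernel[OF assms, symmetric] by simp

section \<open>The kernel inside a pair of groups, and the block maps\<close>

text \<open>By the support of the columns of \<open>core_U\<close>, only columns \<open>a\<close> of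
  group \<open>i\<close> and \<open>b\<close> of group \<open>j\<close> contribute.\<close>

lemma core_kernel_blocks:
  assumes "2 * i + s < n" "2 * i + c < n" "2 * j + t < n" "2 * j + d < n"
    and "s < 2" "c < 2" "t < 2" "d < 2"
  shows "core_kernel n \<Theta> (2 * i + s) (2 * j + t) (2 * i + c) (2 * j + d) =
    (\<Sum>a<card (index_group n i). \<Sum>b<card (index_group n j).
      (core_U n $$ (2 * i + s, 2 * i + a) * cnj (core_U n $$ (2 * i + c, 2 * i + a))) *
      (core_U n $$ (2 * j + d, 2 * j + b) * cnj (core_U n $$ (2 * j + t, 2 * j + b))) *
      phi (core_freq n \<Theta> (2 * j + b) - core_freq n \<Theta> (2 * i + a)))"
proof -
  have U0: "core_U n $$ (2 * i + s, a) = 0" if "a < n" "a div 2 \<noteq> i" for a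
    using assms that by (simp add: core_U_index_eq_0)
  have V0: "core_U n $$ (2 * j + d, b) = 0" if "b < n" "b div 2 \<noteq> j" for b
    using assms that by (simp add: core_U_index_eq_0)
  have "core_kernel n \<Theta> (2 * i + s) (2 * j + t) (2 * i + c) (2 * j + d) =
    (\<Sum>a<n. \<Sum>b<card (index_group n j).
      (core_U n $$ (2 * i + s, a) * cnj (core_U n $$ (2 * i + c, a))) *
      (core_U n $$ (2 * j + d, 2 * j + b) * cnj (core_U n $$ (2 * j + t, 2 * j + b))) *
      core_Phi n \<Theta> $$ (a, 2 * j + b))"
    unfolding core_kernel_def
    by (rule sum.cong[OF refl], rule sum_index_group) (simp add: V0)
  also have "\<dots> = (\<Sum>a<card (index_group n i). \<Sum>b<card (index_group n j).
      (core_U n $$ (2 * i + s, 2 * i + a) * cnj (core_U n $$ (2 * i + c, 2 * i + a))) *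
      (core_U n $$ (2 * j + d, 2 * j + b) * cnj (core_U n $$ (2 * j + t, 2 * j + b))) *
      core_Phi n \<Theta> $$ (2 * i + a, 2 * j + b))"
    by (rule sum_index_group) (simp add: U0)
  finally show ?thesis
    by (simp add: core_Phi_index index_group_less(1))
qed

text \<open>These are the entries of \<open>u u^H\<close> for \<open>u = (1, \<i>) / sqrt 2\<close>
  when \<open>a = 0\<close> and \<open>u = (1, - \<i>) / sqrt 2\<close> when
  \<open>a = 1\<close>.\<close>

lemma core_U_projection:
  assumes "i < n div 2" "s < 2" "c < 2" "a < 2"
  shows "core_U n $$ (2 * i + s, 2 * i + a) * cnj (core_U n $$ (2 * i + c, 2 * i + a)) =
    (if s = c then 1 / 2 else if s = a then - \<i> / 2 else \<i> / 2)"
proof -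
  have "2 * i + 1 < n"
    using assms by linarith
  \<comment> \<open>The squared normalising factor \<open>sqrt 2 / 2\<close> is the
    \<open>1 / 2\<close> of the entries.\<close>
  moreover have "complex_of_real (sqrt 2) * complex_of_real (sqrt 2) = 2"
    by (simp flip: of_real_mult)
  ultimately show ?thesis
    using assms
    by (auto simp: core_U_index less_2_cases_iff)
qed

text \<open>For odd \<open>n\<close> the kernel acts as the identity on the last diagonal block, which vanishes for
  skew-symmetric matrices; the theorem prescribes the zero map there.\<close>

definition core_block :: "nat \<Rightarrow> real vec \<Rightarrow> nat \<Rightarrow> nat \<Rightarrow> real mat \<Rightarrow> real mat" where
  "core_block n \<Theta> i j B = Matrix.mat (card (index_group n i)) (card (index_group n j))
     (\<lambda>(s, t). if i = n div 2 \<and> j = n div 2 then 0 else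
        \<Sum>c<card (index_group n i). \<Sum>d<card (index_group n j).
          Re (core_kernel n \<Theta> (2 * i + s) (2 * j + t) (2 * i + c) (2 * j + d)) * B $$ (c, d))"

lemma core_block_linear: "block_linear n i j (core_block n \<Theta> i j)"
proof -
  let ?V = "module_mat TYPE(real) (card (index_group n i)) (card (index_group n j))"
  interpret vectorspace "class_ring :: real ring" ?V
    by (rule matrix_vs)
  have "core_block n \<Theta> i j \<in> LinearCombinations.module_hom class_ring ?V ?V"
    by (auto simp: module_hom_def module_mat_simps core_block_def sum_distrib_left
        sum.distrib ring_distribs mult_ac intro!: eq_matI)
  then show ?thesis
    unfolding block_linear_def Let_def
    by unfold_locales
qed

section \<open>The vectorised block maps: \<open>frakX\<close> and \<open>frakY\<close>\<close>

lemma sum_lessThan_2: "(\<Sum>s<2. f s) = f 0 + f (1::nat)"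
  by (simp add: numeral_2_eq_2)

lemma sum_atLeast0LessThan_4: "(\<Sum>s = 0..<4. f s) = f 0 + f 1 + f 2 + f (3::nat)"
  by (simp add: eval_nat_numeral add.assoc)

text \<open>Columns in equal positions of their pairs have frequencies differing by
  \<open>\<theta>_i - \<theta>_j\<close> up to sign, which yields \<open>a\<close> and
  \<open>b\<close>; opposite positions yield the sum, hence \<open>c\<close> and
  \<open>d\<close>.\<close>

lemma core_block_pair:
  assumes ij: "i < n div 2" "j < n div 2" and B: "B \<in> carrier_mat 2 2"
  shows "stack_cols (core_block n \<Theta> i j B) =
         frakX (sinc (\<Theta> $ i - \<Theta> $ j)) (cosc (\<Theta> $ i - \<Theta> $ j))
               (sinc (\<Theta> $ i + \<Theta> $ j)) (cosc (\<Theta> $ i + \<Theta> $ j)) *\<^sub>v stack_cols B"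
proof -
  \<comment> \<open>The identity holds for arbitrary reals in these places; hiding the values of
    \<open>sinc\<close> and \<open>cosc\<close> leaves a purely algebraic check.\<close>
  obtain a b c d where abcd: "a = sinc (\<Theta> $ i - \<Theta> $ j)" "b = cosc (\<Theta> $ i - \<Theta> $ j)"
      "c = sinc (\<Theta> $ i + \<Theta> $ j)" "d = cosc (\<Theta> $ i + \<Theta> $ j)"
    by blast
  define P :: "nat \<Rightarrow> nat \<Rightarrow> nat \<Rightarrow> complex"
    where "P s s' \<alpha> = (if s = s' then 1 / 2 else if s = \<alpha> then - \<i> / 2 else \<i> / 2)" for s s' \<alpha>
  \<comment> \<open>The 2 x 2 block of \<open>core_Phi\<close>; the sign of the imaginary part
    records the sign of the frequency difference.\<close>
  define F :: "nat \<Rightarrow> nat \<Rightarrow> complex"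
    where "F \<alpha> \<beta> = (if \<alpha> = \<beta> then Complex a (if \<alpha> = 0 then - b else b)
      else Complex c (if \<alpha> = 0 then - d else d))" for \<alpha> \<beta>
  have "phi (\<Theta> $ i - \<Theta> $ j) = Complex a (- b)" "phi (\<Theta> $ i + \<Theta> $ j) = Complex c (- d)"
    by (simp_all only: phi_def abcd)
  moreover have "phi (\<Theta> $ j - \<Theta> $ i) = cnj (phi (\<Theta> $ i - \<Theta> $ j))"
      "phi (- \<Theta> $ j - \<Theta> $ i) = cnj (phi (\<Theta> $ i + \<Theta> $ j))"
    unfolding cnj_phi by (rule arg_cong[of _ _ phi], simp)+
  ultimately have F: "phi (core_freq n \<Theta> (2 * j + \<beta>) - core_freq n \<Theta> (2 * i + \<alpha>)) = F \<alpha> \<beta>"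
    if "\<alpha> < 2" "\<beta> < 2" for \<alpha> \<beta>
    using that ij
    by (auto simp: less_2_cases_iff core_freq_even core_freq_odd F_def complex_cnj add.commute)
  have card: "card (index_group n i) = 2" "card (index_group n j) = 2"
    using ij by (simp_all add: card_index_group_pair)
  have le: "2 * i + s < n" "2 * j + s < n" if "s < 2" for s
    using that index_group_less(1)[of s n i] index_group_less(1)[of s n j]
    by (simp_all only: card)
  \<comment> \<open>The second projection is taken at \<open>(t', t)\<close>, not
    \<open>(t, t')\<close>, because it multiplies the block from the right.\<close>
  have K: "core_kernel n \<Theta> (2 * i + s) (2 * j + t) (2 * i + s') (2 * j + t') =
      (\<Sum>\<alpha><2. \<Sum>\<beta><2. P s s' \<alpha> * P t' t \<beta> * F \<alpha> \<beta>)"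
    if "s < 2" "t < 2" "s' < 2" "t' < 2" for s t s' t'
    unfolding core_kernel_blocks[OF le(1)[OF that(1)] le(1)[OF that(3)] le(2)[OF that(2)]
        le(2)[OF that(4)] that(1,3,2,4)] card
    by (intro sum.cong refl)
       (use that ij in \<open>simp only: core_U_projection P_def F lessThan_iff\<close>)
  have E: "core_block n \<Theta> i j B $$ (s, t) =
      (\<Sum>s'<2. \<Sum>t'<2. Re (\<Sum>\<alpha><2. \<Sum>\<beta><2. P s s' \<alpha> * P t' t \<beta> * F \<alpha> \<beta>) * B $$ (s', t'))"
    if "s < 2" "t < 2" for s t
  proof -
    have "core_block n \<Theta> i j B $$ (s, t) = (\<Sum>s'<2. \<Sum>t'<2.
        Re (core_kernel n \<Theta> (2 * i + s) (2 * j + t) (2 * i + s') (2 * j + t')) * B $$ (s', t'))"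
      using that ij by (simp add: core_block_def card)
    also have "\<dots> = (\<Sum>s'<2. \<Sum>t'<2.
        Re (\<Sum>\<alpha><2. \<Sum>\<beta><2. P s s' \<alpha> * P t' t \<beta> * F \<alpha> \<beta>) * B $$ (s', t'))"
      by (intro sum.cong refl) (use that in \<open>simp only: K lessThan_iff\<close>)
    finally show ?thesis .
  qed
  have dims: "dim_row (core_block n \<Theta> i j B) = 2" "dim_col (core_block n \<Theta> i j B) = 2"
    by (simp_all add: core_block_def card)
  have "stack_cols (core_block n \<Theta> i j B) = frakX a b c d *\<^sub>v stack_cols B"
  proof (rule eq_vecI)
    show "dim_vec (stack_cols (core_block n \<Theta> i j B)) = dim_vec (frakX a b c d *\<^sub>v stack_cols B)"
      by (simp add: stack_cols_def dims frakX_def mat_of_rows_list_def)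
    fix l
    assume "l < dim_vec (frakX a b c d *\<^sub>v stack_cols B)"
    then have l: "l < 4"
      by (simp add: frakX_def mat_of_rows_list_def)
    \<comment> \<open>Coordinate \<open>l\<close> of the stacked block is its entry
      \<open>(l mod 2, l div 2)\<close>, compared with row \<open>l\<close> of
      \<open>frakX\<close>.\<close>
    then consider "l = 0" | "l = 1" | "l = 2" | "l = 3"
      by linarith
    then show "stack_cols (core_block n \<Theta> i j B) $ l = (frakX a b c d *\<^sub>v stack_cols B) $ l"
      by cases (use B in \<open>simp_all add: stack_cols_def dims E sum_lessThan_2 P_def F_def frakX_def
          mat_of_rows_list_def scalar_prod_def sum_atLeast0LessThan_4 field_simps\<close>)
  qed
  then show ?thesis
    unfolding abcd .
qed

text \<open>The last column of \<open>core_U\<close> has frequency 0 and entry 1, so only the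
  projections of group \<open>j\<close> remain and \<open>phi\<close> is evaluated at
  \<open>\<theta>_j\<close> up to sign.\<close>

lemma core_block_last:
  assumes "odd n" "j < n div 2" and B: "B \<in> carrier_mat 1 2"
  shows "stack_cols (core_block n \<Theta> (n div 2) j B) =
         frakY (sinc (\<Theta> $ j)) (cosc (\<Theta> $ j)) *\<^sub>v stack_cols B"
proof -
  let ?m = "n div 2"
  obtain r s where rs: "r = sinc (\<Theta> $ j)" "s = cosc (\<Theta> $ j)"
    by blast
  define P :: "nat \<Rightarrow> nat \<Rightarrow> nat \<Rightarrow> complex"
    where "P s s' \<alpha> = (if s = s' then 1 / 2 else if s = \<alpha> then - \<i> / 2 else \<i> / 2)" for s s' \<alpha>
  have "phi (\<Theta> $ j) = Complex r (- s)"
    by (simp only: phi_def rs)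
  moreover have "phi (- \<Theta> $ j) = cnj (phi (\<Theta> $ j))"
    by (simp add: cnj_phi)
  ultimately have F: "phi (core_freq n \<Theta> (2 * j + \<beta>) - core_freq n \<Theta> (2 * ?m)) =
      Complex r (if \<beta> = 0 then s else - s)" if "\<beta> < 2" for \<beta>
    using that assms(2) by (auto simp: less_2_cases_iff core_freq_even core_freq_odd complex_cnj)
  have card: "card (index_group n ?m) = 1" "card (index_group n j) = 2"
    using assms by (simp_all add: card_index_group_last card_index_group_pair)
  have le_m: "2 * ?m < n"
    using index_group_less[of 0 n ?m] by (simp add: card)
  have le: "2 * j + t < n" if "t < 2" for t
    using that index_group_less[of t n j] by (simp add: card)
  have U: "core_U n $$ (2 * ?m, 2 * ?m) = 1"
    using le_m by (simp add: core_U_index)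
  have K: "core_kernel n \<Theta> (2 * ?m) (2 * j + t) (2 * ?m) (2 * j + t') =
      (\<Sum>\<beta><2. P t' t \<beta> * Complex r (if \<beta> = 0 then s else - s))"
    if "t < 2" "t' < 2" for t t'
  proof -
    have "core_kernel n \<Theta> (2 * ?m) (2 * j + t) (2 * ?m) (2 * j + t') =
      (\<Sum>\<beta><2. core_U n $$ (2 * j + t', 2 * j + \<beta>) * cnj (core_U n $$ (2 * j + t, 2 * j + \<beta>)) *
        phi (core_freq n \<Theta> (2 * j + \<beta>) - core_freq n \<Theta> (2 * ?m)))"
      using core_kernel_blocks[of ?m 0 n 0 j t t' \<Theta>] that le_m by (simp add: le card U)
    also have "\<dots> = (\<Sum>\<beta><2. P t' t \<beta> * Complex r (if \<beta> = 0 then s else - s))"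
      by (intro sum.cong refl)
         (use that assms(2) in \<open>simp only: core_U_projection P_def F lessThan_iff\<close>)
    finally show ?thesis .
  qed
  have E: "core_block n \<Theta> ?m j B $$ (0, t) =
      (\<Sum>t'<2. Re (\<Sum>\<beta><2. P t' t \<beta> * Complex r (if \<beta> = 0 then s else - s)) * B $$ (0, t'))"
    if "t < 2" for t
  proof -
    have "core_block n \<Theta> ?m j B $$ (0, t) = (\<Sum>t'<2.
        Re (core_kernel n \<Theta> (2 * ?m) (2 * j + t) (2 * ?m) (2 * j + t')) * B $$ (0, t'))"
      using that assms(2) by (simp add: core_block_def card)
    also have "\<dots> = (\<Sum>t'<2.
        Re (\<Sum>\<beta><2. P t' t \<beta> * Complex r (if \<beta> = 0 then s else - s)) * B $$ (0, t'))"
      by (intro sum.cong refl) (use that in \<open>simp only: K lessThan_iff\<close>)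
    finally show ?thesis .
  qed
  have dims: "dim_row (core_block n \<Theta> ?m j B) = 1" "dim_col (core_block n \<Theta> ?m j B) = 2"
    by (simp_all add: core_block_def card)
  have "stack_cols (core_block n \<Theta> ?m j B) = frakY r s *\<^sub>v stack_cols B"
  proof (rule eq_vecI)
    show "dim_vec (stack_cols (core_block n \<Theta> ?m j B)) = dim_vec (frakY r s *\<^sub>v stack_cols B)"
      by (simp add: stack_cols_def dims frakY_def mat_of_rows_list_def)
    fix l
    assume "l < dim_vec (frakY r s *\<^sub>v stack_cols B)"
    then have "l < 2"
      by (simp add: frakY_def mat_of_rows_list_def)
    then consider "l = 0" | "l = 1"
      by linarith
    then show "stack_cols (core_block n \<Theta> ?m j B) $ l = (frakY r s *\<^sub>v stack_cols B) $ l"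
      by cases (use B in \<open>simp_all add: stack_cols_def dims E sum_lessThan_2 P_def frakY_def
          mat_of_rows_list_def scalar_prod_def lessThan_atLeast0[symmetric] field_simps\<close>)
  qed
  then show ?thesis
    unfolding rs .
qed

section \<open>Skew symmetry and the blockwise action\<close>

lemma skew_mats_index:
  assumes "M \<in> skew_mats n" "p < n" "q < n"
  shows "M $$ (q, p) = - M $$ (p, q)"
proof -
  have "M \<in> carrier_mat n n" "(M + transpose_mat M) $$ (p, q) = 0"
    using assms by (auto simp: skew_mats_def)
  then show ?thesis
    using assms by auto
qed

lemma skew_matsI:
  assumes "M \<in> carrier_mat n n" "\<And>p q. p < n \<Longrightarrow> q < n \<Longrightarrow> M $$ (q, p) = - M $$ (p, q)"
  shows "M \<in> skew_mats n"
proof -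
  have "M + transpose_mat M = 0\<^sub>m n n"
  proof (rule eq_matI)
    fix p q
    assume "p < dim_row (0\<^sub>m n n :: real mat)" "q < dim_col (0\<^sub>m n n :: real mat)"
    then have "p < n" "q < n"
      by simp_all
    with assms(1) assms(2)[of p q]
    show "(M + transpose_mat M) $$ (p, q) = 0\<^sub>m n n $$ (p, q)"
      by simp
  qed (use assms(1) in auto)
  then show ?thesis
    using assms(1) by (simp add: skew_mats_def)
qed

text \<open>Groups beyond the last one are empty, so the block equation is trivial there and holds
  for all \<open>i\<close> and \<open>j\<close>.\<close>

lemma core_map_skew:
  assumes M: "M \<in> skew_mats n"
  shows "\<exists>N\<in>skew_mats n. core_map n \<Theta> M = map_mat complex_of_real N \<and>
    (\<forall>i j. block N i j = core_block n \<Theta> i j (block M i j))"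
proof -
  have Mc: "M \<in> carrier_mat n n"
    using M by (simp add: skew_mats_def)
  \<comment> \<open>Taking real parts makes \<open>N\<close> real by construction and loses nothing,
    by \<open>core_kernel_real\<close>.\<close>
  define N where "N = Matrix.mat n n (\<lambda>(p, q).
    \<Sum>c<n. \<Sum>d<n. Re (core_kernel n \<Theta> p q c d) * M $$ (c, d))"
  have Nc: "N \<in> carrier_mat n n"
    by (simp add: N_def)
  have skew: "N \<in> skew_mats n"
  proof (rule skew_matsI[OF Nc])
    fix p q
    assume pq: "p < n" "q < n"
    \<comment> \<open>The real kernel is unchanged when both index pairs are swapped, so the sign
      comes from \<open>M\<close> alone.\<close>
    have entry: "Re (core_kernel n \<Theta> q p d c) * M $$ (d, c) =
        - (Re (core_kernel n \<Theta> p q c d) * M $$ (c, d))" if "c < n" "d < n" for c d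
      using core_kernel_swap[OF pq that] skew_mats_index[OF M that] by simp
    have "N $$ (q, p) = (\<Sum>d<n. \<Sum>c<n. Re (core_kernel n \<Theta> q p d c) * M $$ (d, c))"
      using pq by (simp add: N_def)
    also have "\<dots> = (\<Sum>d<n. \<Sum>c<n. - (Re (core_kernel n \<Theta> p q c d) * M $$ (c, d)))"
      by (intro sum.cong refl) (simp only: entry lessThan_iff)
    also have "\<dots> = - (\<Sum>d<n. \<Sum>c<n. Re (core_kernel n \<Theta> p q c d) * M $$ (c, d))"
      by (simp add: sum_negf)
    also have "\<dots> = - N $$ (p, q)"
      using pq by (subst sum.swap) (simp add: N_def)
    finally show "N $$ (q, p) = - N $$ (p, q)" .
  qed
  have core: "core_map n \<Theta> M = map_mat complex_of_real N"
    using core_map_carrier[OF Mc, of \<Theta>]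
    by (intro eq_matI) (auto simp: core_map_index[OF Mc] N_def core_kernel_real intro!: sum.cong)
  have "block N i j = core_block n \<Theta> i j (block M i j)" for i j
  proof (cases "i = n div 2 \<and> j = n div 2")
    case True
    \<comment> \<open>For odd \<open>n\<close> this block is one diagonal entry of the
      skew-symmetric \<open>N\<close>, which agrees with the zero map; for even \<open>n\<close> it
      is empty.\<close>
    have "N $$ (2 * i + s, 2 * j + t) = 0"
      if "s < card (index_group n i)" "t < card (index_group n j)" for s t
    proof -
      have "2 * i + s < n" "2 * j + t < n"
        using that by (auto simp: index_group_less)
      then have "2 * i + s = 2 * j + t"
        using True by linarith
      with \<open>2 * i + s < n\<close> show ?thesis
        using skew_mats_index[OF skew, of "2 * i + s" "2 * i + s"] by simp
    qed
    then show ?thesis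
      using True by (auto simp: block_eq[OF Nc] core_block_def intro!: eq_matI)
  next
    case False
    have "N $$ (2 * i + s, 2 * j + t) =
        (\<Sum>c<card (index_group n i). \<Sum>d<card (index_group n j).
          Re (core_kernel n \<Theta> (2 * i + s) (2 * j + t) (2 * i + c) (2 * j + d)) *
          M $$ (2 * i + c, 2 * j + d))"
      if st: "s < card (index_group n i)" "t < card (index_group n j)" for s t
    proof -
      note * = index_group_less[OF st(1)] index_group_less[OF st(2)]
      \<comment> \<open>First the column sum shrinks to group \<open>j\<close>, then the row sum to
        group \<open>i\<close>.\<close>
      have "N $$ (2 * i + s, 2 * j + t) =
        (\<Sum>c<n. \<Sum>d<card (index_group n j).
          Re (core_kernel n \<Theta> (2 * i + s) (2 * j + t) c (2 * j + d)) * M $$ (c, 2 * j + d))"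
        using * by (simp add: N_def) (rule sum.cong[OF refl], rule sum_index_group,
          simp add: core_kernel_eq_0)
      also have "\<dots> = (\<Sum>c<card (index_group n i). \<Sum>d<card (index_group n j).
          Re (core_kernel n \<Theta> (2 * i + s) (2 * j + t) (2 * i + c) (2 * j + d)) *
          M $$ (2 * i + c, 2 * j + d))"
        using * by (intro sum_index_group) (simp add: core_kernel_eq_0 index_group_less)
      finally show ?thesis .
    qed
    then show ?thesis
      using False by (auto simp: block_eq[OF Nc] block_eq[OF Mc] core_block_def intro!: eq_matI)
  qed
  with skew core show ?thesis
    by blast
qed

theorem proposition3p3:
  fixes n m k :: nat and \<Theta> :: "real vec"
  assumes "n \<ge> 2" and "m = n div 2" and "k = (n + 1) div 2"
    and "\<Theta> \<in> carrier_vec m"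
  shows "\<exists>C :: nat \<Rightarrow> nat \<Rightarrow> real mat \<Rightarrow> real mat.
    (\<forall>i<k. \<forall>j<k. block_linear n i j (C i j)) \<and>
    (\<forall>M\<in>skew_mats n. \<exists>N\<in>skew_mats n.
       core_map n \<Theta> M = map_mat complex_of_real N \<and>
       (\<forall>i<k. \<forall>j<k. block N i j = C i j (block M i j))) \<and>
    (\<forall>i<m. \<forall>j<m. \<forall>B\<in>carrier_mat 2 2.
       stack_cols (C i j B) =
         frakX (sinc (\<Theta> $ i - \<Theta> $ j)) (cosc (\<Theta> $ i - \<Theta> $ j))
               (sinc (\<Theta> $ i + \<Theta> $ j)) (cosc (\<Theta> $ i + \<Theta> $ j)) *\<^sub>v stack_cols B) \<and>
    (odd n \<longrightarrow>
       (\<forall>j<m. \<forall>B\<in>carrier_mat 1 2.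
          stack_cols (C m j B) = frakY (sinc (\<Theta> $ j)) (cosc (\<Theta> $ j)) *\<^sub>v stack_cols B) \<and>
       (\<forall>B\<in>carrier_mat 1 1. C m m B = 0\<^sub>m 1 1))"
proof (intro exI[of _ "core_block n \<Theta>"] conjI allI ballI impI)
  show "\<exists>N\<in>skew_mats n. core_map n \<Theta> M = map_mat complex_of_real N \<and>
      (\<forall>i<k. \<forall>j<k. block N i j = core_block n \<Theta> i j (block M i j))"
    if "M \<in> skew_mats n" for M
    using core_map_skew[OF that, of \<Theta>] by blast
  \<comment> \<open>On the last diagonal block \<open>core_block\<close> is the zero map by
    definition; only the size 1 x 1 has to be found.\<close>
  show "core_block n \<Theta> m m B = 0\<^sub>m 1 1" if "odd n" for B
    using card_index_group_last[OF that] assms(2)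
    by (auto simp: core_block_def intro!: eq_matI)
qed (use assms(2) in \<open>auto simp: core_block_linear core_block_pair core_block_last\<close>)

end
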